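(* Let $n$ be even, let $A\in\mathbb{R}^{n\times n}$ be such that $M=I-A$ is skew-symmetric ($M^T=-M$), and let $b\in\mathbb{R}^n$. Let $m^*$ be the largest modulus of an eigenvalue of $M$. Then the worst-case root-convergence factor of GMRES(1) applied to $Ax=b$ is $$\varrho^*_{GMRES(1),ss}=\frac{m^*}{\sqrt{1+(m^* )^2}}<1.$$
   Context: $\langle\cdot,\cdot\rangle$ and $\|\cdot\|$ are the Euclidean inner product and norm. For $v\neq 0$ put $\alpha(v)=\frac{\langle v,Av\rangle}{\langle Av,Av\rangle}$. GMRES(1) (minimal residual iteration) for $Ax=b$: given $x_0\in\mathbb{R}^n$, set $r_0=Ax_0-b$ and, for $k=0,1,2,\dots$, $x_{k+1}=x_k-\alpha(r_k)r_k$ and $r_{k+1}=r_k-\alpha(r_k)Ar_k$; if $r_k=0$ the iteration stops and one sets $r_m=0$ for all $m\ge k$. The root-convergence factor for a given initial residual is $\varrho(r_0)=\limsup_{k\to\infty}\|r_k\|^{1/k}$, and the worst-case root-convergence factor is the maximum of $\varrho(r_0)$ over all initial guesses $x_0\in\mathbb{R}^n$. *)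

theory Defs
  imports "HOL-Analysis.Analysis"
begin

definition step_length :: "real^'n^'n \<Rightarrow> real^'n \<Rightarrow> real" where
  "step_length A v = (v \<bullet> (A *v v)) / ((A *v v) \<bullet> (A *v v))"

(* The state after k steps is the pair (x_k, r_k).  The residual has the sign convention
   r_0 = A x_0 - b.  Once the residual vanishes the iterate is kept and all later residuals
   are 0. *)
primrec gmres1 :: "real^'n^'n \<Rightarrow> real^'n \<Rightarrow> real^'n \<Rightarrow> nat \<Rightarrow> (real^'n) \<times> (real^'n)" where
  "gmres1 A b x0 0 = (x0, A *v x0 - b)"
| "gmres1 A b x0 (Suc k) =
    (let (x, r) = gmres1 A b x0 k in
       if r = 0 then (x, 0)
       else (x - step_length A r *\<^sub>R r, r - step_length A r *\<^sub>R (A *v r)))"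

definition gmres1_residual :: "real^'n^'n \<Rightarrow> real^'n \<Rightarrow> real^'n \<Rightarrow> nat \<Rightarrow> real^'n" where
  "gmres1_residual A b x0 k = snd (gmres1 A b x0 k)"

(* The limsup is taken in the extended reals, so that it always exists. *)
definition root_convergence_factor :: "real^'n^'n \<Rightarrow> real^'n \<Rightarrow> real^'n \<Rightarrow> ereal" where
  "root_convergence_factor A b x0 =
    limsup (\<lambda>k. ereal (root k (norm (gmres1_residual A b x0 k))))"

(* A predicate rather than a supremum: the worst-case factor is a maximum, so it has to be
   attained by some initial guess. *)
definition is_worst_case_factor :: "real^'n^'n \<Rightarrow> real^'n \<Rightarrow> ereal \<Rightarrow> bool" where
  "is_worst_case_factor A b \<rho> \<longleftrightarrow>
    (\<exists>x0. root_convergence_factor A b x0 = \<rho>) \<and> (\<forall>x0. root_convergence_factor A b x0 \<le> \<rho>)"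

(* The eigenvalues of a real matrix are its complex ones, with complex eigenvectors. *)
definition eigenvalues :: "real^'n^'n \<Rightarrow> complex set" where
  "eigenvalues M =
    {l. \<exists>v :: complex^'n. v \<noteq> 0 \<and> map_matrix complex_of_real M *v v = l *s v}"

definition max_eigenvalue_modulus :: "real^'n^'n \<Rightarrow> real" where
  "max_eigenvalue_modulus M = Max (cmod ` eigenvalues M)"

end

theory Submission
  imports Defs
begin

text \<open>
  Since \<open>A = I - M\<close> with \<open>M\<close> skew-symmetric, \<open>\<langle>v, A v\<rangle> = |v|\<^sup>2\<close> and \<open>|A v|\<^sup>2 = |v|\<^sup>2 + |M v|\<^sup>2\<close>, so
  one step of the iteration maps a residual \<open>r\<close> to some \<open>r'\<close> with
  \<open>|r'|\<^sup>2 = |r|\<^sup>2 |M r|\<^sup>2 / (|r|\<^sup>2 + |M r|\<^sup>2)\<close> (lemma \<open>norm_residual_step\<close>).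
  The reduction \<open>|r'| / |r|\<close> is thus an increasing function of \<open>|M r| / |r|\<close>, and with \<open>s\<close> the
  spectral norm of \<open>M\<close> no step reduces the residual by a factor worse than
  \<open>q = s / sqrt (1 + s\<^sup>2)\<close>.

  This factor is attained in every step by the residuals from the eigenspace
  \<open>E = {v. M\<^sup>2 v = - s\<^sup>2 v}\<close>: on \<open>E\<close> one has \<open>|M v| = s |v|\<close> exactly, and \<open>E\<close> is invariant under
  \<open>M\<close> and hence under the iteration. The space \<open>E\<close> is nontrivial because it contains every unit
  vector at which \<open>|M v|\<close> is maximal (lemma \<open>skew_spectral_norm_attained\<close>), and any of its
  vectors is an initial residual because \<open>A\<close> is invertible.

  Finally, \<open>s\<close> is the largest modulus of an eigenvalue. The eigenvalues of \<open>M\<close> are purely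
  imaginary, and their moduli are precisely the numbers \<open>t \<ge> 0\<close> for which \<open>- t\<^sup>2\<close> is an
  eigenvalue of the real symmetric matrix \<open>M\<^sup>2\<close> (lemma \<open>skew_eigenvalue_moduli\<close>); so complex
  eigenvectors can be avoided from there on.
\<close>

section \<open>Eigenvalues of skew-symmetric matrices\<close>

lemma matrix_vector_mult_uminus:
  fixes M :: "real^'n^'m"
  shows "M *v (- w) = - (M *v w)"
  using matrix_vector_mult_scaleR[of M "-1" w] by simp

lemma skew_inner:
  fixes M :: "real^'n^'n"
  assumes "transpose M = - M"
  shows "x \<bullet> (M *v y) = - ((M *v x) \<bullet> y)"
proof -
  have "x \<bullet> (M *v y) = (transpose M *v x) \<bullet> y"
    by (metis dot_lmul_matrix transpose_matrix_vector)
  also have "transpose M *v x = - (M *v x)"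
    using assms by (simp add: matrix_vector_mult_def vec_eq_iff sum_negf)
  finally show ?thesis by simp
qed

lemma skew_inner_self:
  fixes M :: "real^'n^'n"
  assumes "transpose M = - M"
  shows "x \<bullet> (M *v x) = 0"
  using skew_inner[OF assms, of x x] by (simp add: inner_commute)

lemma norm_mult_skew_eigenvector:
  fixes M :: "real^'n^'n"
  assumes skew: "transpose M = - M" and "M *v (M *v v) = - (t\<^sup>2 *\<^sub>R v)" and "t \<ge> 0"
  shows "norm (M *v v) = t * norm v"
proof -
  have "(norm (M *v v))\<^sup>2 = - (v \<bullet> (M *v (M *v v)))"
    by (simp add: skew_inner[OF skew, of v] power2_norm_eq_inner)
  also have "\<dots> = (t * norm v)\<^sup>2"
    by (simp add: assms(2) power_mult_distrib power2_norm_eq_inner)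
  finally show ?thesis
    using assms(3) by (simp add: power2_eq_iff_nonneg)
qed

text \<open>
  Rayleigh's principle. If \<open>v\<close> is a unit vector that maximizes \<open>|M v|\<close> and \<open>s\<close> is the maximum,
  then \<open>|M\<^sup>2 v + s\<^sup>2 v|\<^sup>2 = |M\<^sup>2 v|\<^sup>2 - 2 s\<^sup>2 |M v|\<^sup>2 + s\<^sup>4 \<le> s\<^sup>4 - 2 s\<^sup>4 + s\<^sup>4 = 0\<close>, so that \<open>v\<close> is an
  eigenvector of \<open>M\<^sup>2\<close>.
\<close>

lemma skew_spectral_norm_attained:
  fixes M :: "real^'n^'n"
  assumes skew: "transpose M = - M"
  obtains s v where "s \<ge> 0" "\<And>x. norm (M *v x) \<le> s * norm x"
    "v \<noteq> 0" "M *v (M *v v) = - (s\<^sup>2 *\<^sub>R v)"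
proof -
  let ?S = "sphere (0 :: real^'n) 1"
  have "?S \<noteq> {}"
    using vector_choose_size[of 1] by auto
  moreover have "continuous_on ?S (\<lambda>x. norm (M *v x))"
    by (intro continuous_intros matrix_vector_mult_linear_continuous_on)
  ultimately obtain v where v: "v \<in> ?S" and max: "\<And>x. x \<in> ?S \<Longrightarrow> norm (M *v x) \<le> norm (M *v v)"
    using continuous_attains_sup[of ?S "\<lambda>x. norm (M *v x)"] by auto
  define s where "s = norm (M *v v)"
  have bound: "norm (M *v x) \<le> s * norm x" for x
  proof (cases "x = 0")
    case False
    then have "norm (M *v (x /\<^sub>R norm x)) \<le> s"
      unfolding s_def by (intro max) auto
    then show ?thesis
      using False by (simp add: matrix_vector_mult_scaleR field_simps)
  qed simp
  have "norm (M *v (M *v v)) \<le> s\<^sup>2"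
    using bound[of "M *v v"] by (simp add: s_def power2_eq_square)
  then have le: "(norm (M *v (M *v v)))\<^sup>2 \<le> (s\<^sup>2)\<^sup>2"
    by (intro power_mono) auto
  have "(M *v (M *v v)) \<bullet> v = - s\<^sup>2"
    using skew_inner[OF skew, of v "M *v v"]
    by (simp add: s_def power2_norm_eq_inner inner_commute)
  moreover have "v \<bullet> v = 1"
    using v by (simp add: norm_eq_1)
  ultimately have "(norm (M *v (M *v v) + s\<^sup>2 *\<^sub>R v))\<^sup>2 = (norm (M *v (M *v v)))\<^sup>2 - (s\<^sup>2)\<^sup>2"
    unfolding power2_norm_eq_inner
    by (simp add: inner_left_distrib inner_right_distrib inner_commute power2_eq_square)
  with le have "(norm (M *v (M *v v) + s\<^sup>2 *\<^sub>R v))\<^sup>2 \<le> 0"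
    by linarith
  then have "M *v (M *v v) = - (s\<^sup>2 *\<^sub>R v)"
    by (simp add: add_eq_0_iff2)
  moreover have "s \<ge> 0" "v \<noteq> 0"
    using v by (auto simp: s_def)
  ultimately show ?thesis
    using bound that by blast
qed

text \<open>
  A complex eigenvector \<open>x + i y\<close> with eigenvalue \<open>a + i b\<close> amounts to the two real equations
  \<open>M x = a x - b y\<close> and \<open>M y = b x + a y\<close>.
\<close>

lemma eigenvalues_iff_real_pair:
  fixes M :: "real^'n^'n"
  shows "l \<in> eigenvalues M \<longleftrightarrow>
    (\<exists>x y. (x \<noteq> 0 \<or> y \<noteq> 0) \<and> M *v x = Re l *\<^sub>R x - Im l *\<^sub>R y \<and> M *v y = Im l *\<^sub>R x + Re l *\<^sub>R y)"
    (is "_ \<longleftrightarrow> (\<exists>x y. ?P x y)")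
proof
  assume "l \<in> eigenvalues M"
  then obtain v :: "complex^'n" where "v \<noteq> 0"
    and ev: "map_matrix complex_of_real M *v v = l *s v"
    by (auto simp: eigenvalues_def)
  have sum: "l * v $ i = (\<Sum>j\<in>UNIV. complex_of_real (M $ i $ j) * v $ j)" for i
    using arg_cong[OF ev, of "\<lambda>w. w $ i"] by (simp add: matrix_vector_mult_def map_matrix_def)
  have "(\<Sum>j\<in>UNIV. M $ i $ j * Re (v $ j)) = Re (l * v $ i)"
    "(\<Sum>j\<in>UNIV. M $ i $ j * Im (v $ j)) = Im (l * v $ i)" for i
    unfolding sum by simp_all
  moreover have "(\<chi> i. Re (v $ i)) \<noteq> 0 \<or> (\<chi> i. Im (v $ i)) \<noteq> 0"
    using \<open>v \<noteq> 0\<close> by (auto simp: vec_eq_iff complex_eq_iff)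
  ultimately have "?P (\<chi> i. Re (v $ i)) (\<chi> i. Im (v $ i))"
    by (simp add: vec_eq_iff matrix_vector_mult_def algebra_simps)
  then show "\<exists>x y. ?P x y" by blast
next
  assume "\<exists>x y. ?P x y"
  then obtain x y where P: "?P x y" by blast
  define v where "v = (\<chi> i. Complex (x $ i) (y $ i))"
  have "(\<Sum>j\<in>UNIV. M $ i $ j * x $ j) = Re l * x $ i - Im l * y $ i"
    "(\<Sum>j\<in>UNIV. M $ i $ j * y $ j) = Im l * x $ i + Re l * y $ i" for i
    using P by (auto simp: vec_eq_iff matrix_vector_mult_def)
  then have "map_matrix complex_of_real M *v v = l *s v"
    by (simp add: v_def vec_eq_iff matrix_vector_mult_def map_matrix_def complex_eq_iff
        algebra_simps)
  moreover have "v \<noteq> 0"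
    using P by (auto simp: v_def vec_eq_iff complex_eq_iff)
  ultimately show "l \<in> eigenvalues M"
    by (auto simp: eigenvalues_def)
qed

text \<open>
  With \<open>x\<close>, \<open>y\<close>, \<open>a\<close>, \<open>b\<close> as above, \<open>\<langle>x, M x\<rangle> = \<langle>y, M y\<rangle> = 0\<close> adds up to
  \<open>a (|x|\<^sup>2 + |y|\<^sup>2) = 0\<close>. So \<open>a = 0\<close>, and applying \<open>M\<close> twice gives \<open>M\<^sup>2 x = - b\<^sup>2 x\<close> and
  \<open>M\<^sup>2 y = - b\<^sup>2 y\<close>. Conversely, if \<open>M\<^sup>2 v = - t\<^sup>2 v\<close>, then \<open>(t v, - M v)\<close> is a pair for the
  eigenvalue \<open>i t\<close>, nonzero unless \<open>t = 0\<close> and \<open>M v = 0\<close>; in that case \<open>v\<close> itself is an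
  eigenvector for \<open>0\<close>.
\<close>

lemma skew_eigenvalue_moduli:
  fixes M :: "real^'n^'n"
  assumes skew: "transpose M = - M"
  shows "cmod ` eigenvalues M = {t. t \<ge> 0 \<and> (\<exists>v. v \<noteq> 0 \<and> M *v (M *v v) = - (t\<^sup>2 *\<^sub>R v))}"
proof (intro equalityI subsetI)
  fix t assume "t \<in> cmod ` eigenvalues M"
  then obtain l where t: "t = cmod l" and l: "l \<in> eigenvalues M"
    by blast
  from l obtain x y where nz: "x \<noteq> 0 \<or> y \<noteq> 0"
    and x: "M *v x = Re l *\<^sub>R x - Im l *\<^sub>R y" and y: "M *v y = Im l *\<^sub>R x + Re l *\<^sub>R y"
    unfolding eigenvalues_iff_real_pair by (elim exE conjE)
  have "x \<bullet> (M *v x) + y \<bullet> (M *v y) = Re l * (x \<bullet> x + y \<bullet> y)"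
    by (simp add: x y inner_diff inner_add inner_commute algebra_simps)
  then have "Re l * (x \<bullet> x + y \<bullet> y) = 0"
    by (simp add: skew_inner_self[OF skew])
  moreover have "x \<bullet> x + y \<bullet> y \<noteq> 0"
    using nz by (simp add: add_nonneg_eq_0_iff)
  ultimately have re: "Re l = 0"
    by simp
  have t2: "t\<^sup>2 = (Im l)\<^sup>2"
    by (simp add: t cmod_def re)
  have "M *v (M *v x) = - (t\<^sup>2 *\<^sub>R x)" "M *v (M *v y) = - (t\<^sup>2 *\<^sub>R y)"
    by (simp_all add: x y re t2[unfolded power2_eq_square] matrix_vector_mult_scaleR
        power2_eq_square matrix_vector_mult_uminus)
  with nz show "t \<in> {t. t \<ge> 0 \<and> (\<exists>v. v \<noteq> 0 \<and> M *v (M *v v) = - (t\<^sup>2 *\<^sub>R v))}"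
    by (auto simp: t)
next
  fix t assume "t \<in> {t. t \<ge> 0 \<and> (\<exists>v. v \<noteq> 0 \<and> M *v (M *v v) = - (t\<^sup>2 *\<^sub>R v))}"
  then obtain v where t: "t \<ge> 0" and v: "v \<noteq> 0" "M *v (M *v v) = - (t\<^sup>2 *\<^sub>R v)"
    by blast
  have "Complex 0 t \<in> eigenvalues M"
  proof (cases "t = 0")
    case True
    then have "M *v v = 0"
      using norm_mult_skew_eigenvector[OF skew v(2) t] by simp
    then show ?thesis
      unfolding eigenvalues_iff_real_pair using True v(1) by (intro exI[of _ v]) auto
  next
    case False
    then show ?thesis
      unfolding eigenvalues_iff_real_pair using v
      by (intro exI[of _ "t *\<^sub>R v"] exI[of _ "- (M *v v)"])
        (auto simp: matrix_vector_mult_scaleR matrix_vector_mult_uminus power2_eq_square)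
  qed
  moreover have "cmod (Complex 0 t) = t"
    using t by (simp add: cmod_def)
  ultimately show "t \<in> cmod ` eigenvalues M"
    by force
qed

text \<open>
  Eigenvectors of the symmetric matrix \<open>M\<^sup>2\<close> for different eigenvalues are orthogonal, hence
  linearly independent, and an independent set is finite.
\<close>

lemma finite_skew_eigenvalue_moduli:
  fixes M :: "real^'n^'n"
  assumes skew: "transpose M = - M"
  shows "finite (cmod ` eigenvalues M)"
proof -
  let ?T = "cmod ` eigenvalues M"
  have "\<forall>t\<in>?T. \<exists>v. t \<ge> 0 \<and> v \<noteq> 0 \<and> M *v (M *v v) = - (t\<^sup>2 *\<^sub>R v)"
    unfolding skew_eigenvalue_moduli[OF skew] by blast
  then obtain f where f: "\<And>t. t \<in> ?T \<Longrightarrow> t \<ge> 0 \<and> f t \<noteq> 0 \<and> M *v (M *v f t) = - (t\<^sup>2 *\<^sub>R f t)"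
    unfolding bchoice_iff by blast
  have orth: "f t \<bullet> f u = 0" if "t \<in> ?T" "u \<in> ?T" "t \<noteq> u" for t u
  proof -
    have "f t \<bullet> (M *v (M *v f u)) = (M *v (M *v f t)) \<bullet> f u"
      by (simp add: skew_inner[OF skew])
    then have "t\<^sup>2 * (f t \<bullet> f u) = u\<^sup>2 * (f t \<bullet> f u)"
      using f[OF that(1)] f[OF that(2)] by auto
    moreover have "t\<^sup>2 \<noteq> u\<^sup>2"
      using f[OF that(1)] f[OF that(2)] that(3) by (simp add: power2_eq_iff_nonneg)
    ultimately show ?thesis by simp
  qed
  have "inj_on f ?T"
  proof (rule inj_onI, rule ccontr)
    fix t u assume tu: "t \<in> ?T" "u \<in> ?T" "f t = f u" "t \<noteq> u"
    then show False
      using orth[OF tu(1,2,4)] f[OF tu(1)] by simp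
  qed
  moreover have "independent (f ` ?T)"
  proof (rule pairwise_orthogonal_independent)
    show "pairwise orthogonal (f ` ?T)"
    proof (rule pairwiseI, elim imageE[of _ f])
      fix v w t u assume tu: "v = f t" "t \<in> ?T" "w = f u" "u \<in> ?T" "v \<noteq> w"
      then have "t \<noteq> u"
        by metis
      then show "orthogonal v w"
        using orth[OF tu(2,4)] tu(1,3) by (simp add: orthogonal_def)
    qed
    show "0 \<notin> f ` ?T"
    proof (rule notI, elim imageE[of _ f])
      fix t assume "0 = f t" "t \<in> ?T"
      then show False
        using f[of t] by simp
    qed
  qed
  ultimately show ?thesis
    using finiteI_independent finite_imageD by blast
qed

lemma skew_max_eigenvalue_modulus:
  fixes M :: "real^'n^'n"
  assumes skew: "transpose M = - M"
  obtains v where "max_eigenvalue_modulus M \<ge> 0"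
    "\<And>x. norm (M *v x) \<le> max_eigenvalue_modulus M * norm x"
    "v \<noteq> 0" "M *v (M *v v) = - ((max_eigenvalue_modulus M)\<^sup>2 *\<^sub>R v)"
proof -
  obtain s v where s: "s \<ge> 0" "\<And>x. norm (M *v x) \<le> s * norm x"
    and v: "v \<noteq> 0" "M *v (M *v v) = - (s\<^sup>2 *\<^sub>R v)"
    using skew_spectral_norm_attained[OF skew] by blast
  have "max_eigenvalue_modulus M = s"
    unfolding max_eigenvalue_modulus_def
  proof (rule Max_eqI[OF finite_skew_eigenvalue_moduli[OF skew]])
    fix t assume "t \<in> cmod ` eigenvalues M"
    then obtain w where "t \<ge> 0" "w \<noteq> 0" "M *v (M *v w) = - (t\<^sup>2 *\<^sub>R w)"
      unfolding skew_eigenvalue_moduli[OF skew] by blast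
    then have "t * norm w \<le> s * norm w"
      using norm_mult_skew_eigenvector[OF skew] s(2) by metis
    with \<open>w \<noteq> 0\<close> show "t \<le> s"
      by simp
  next
    show "s \<in> cmod ` eigenvalues M"
      unfolding skew_eigenvalue_moduli[OF skew] using s(1) v by blast
  qed
  with s v that show ?thesis by blast
qed

section \<open>One step of the iteration\<close>

definition residual_step :: "real^'n^'n \<Rightarrow> real^'n \<Rightarrow> real^'n" where
  "residual_step A r = r - step_length A r *\<^sub>R (A *v r)"

text \<open>
  The stopping rule needs no case distinction for the residuals, since the step maps \<open>0\<close> to \<open>0\<close>.
\<close>

lemma gmres1_residual_Suc:
  "gmres1_residual A b x0 (Suc k) = residual_step A (gmres1_residual A b x0 k)"
  by (simp add: gmres1_residual_def residual_step_def split: prod.split)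

lemma gmres1_residual_0: "gmres1_residual A b x0 0 = A *v x0 - b"
  by (simp add: gmres1_residual_def)

text \<open>
  The new residual is the component of \<open>r\<close> orthogonal to \<open>A r\<close>, so
  \<open>|r'|\<^sup>2 = |r|\<^sup>2 - \<langle>r, A r\<rangle>\<^sup>2 / |A r|\<^sup>2\<close> with \<open>\<langle>r, A r\<rangle> = |r|\<^sup>2\<close> and
  \<open>|A r|\<^sup>2 = |r|\<^sup>2 + |M r|\<^sup>2\<close>.
\<close>

lemma norm_residual_step:
  fixes M :: "real^'n^'n"
  assumes skew: "transpose M = - M"
  shows "(norm (residual_step (mat 1 - M) r))\<^sup>2 =
    (norm r)\<^sup>2 * (norm (M *v r))\<^sup>2 / ((norm r)\<^sup>2 + (norm (M *v r))\<^sup>2)"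
proof (cases "r = 0")
  case True
  then show ?thesis by (simp add: residual_step_def)
next
  case False
  define p q where "p = r \<bullet> r" and "q = (M *v r) \<bullet> (M *v r)"
  have pos: "p + q > 0"
    using False by (simp add: p_def q_def add_pos_nonneg)
  have A: "(mat 1 - M) *v r = r - M *v r"
    by (simp add: matrix_vector_mult_diff_rdistrib)
  have rMr: "r \<bullet> (M *v r) = 0" "(M *v r) \<bullet> r = 0"
    using skew_inner_self[OF skew, of r] by (simp_all add: inner_commute)
  have len: "step_length (mat 1 - M) r = p / (p + q)"
    by (simp add: step_length_def A inner_diff rMr p_def q_def)
  define \<alpha> where "\<alpha> = p / (p + q)"
  have \<alpha>: "\<alpha> * (p + q) = p"
    using pos by (simp add: \<alpha>_def)
  have "(norm (residual_step (mat 1 - M) r))\<^sup>2 = p - 2 * \<alpha> * p + \<alpha> * (\<alpha> * (p + q))"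
    unfolding residual_step_def len A power2_norm_eq_inner \<alpha>_def[symmetric]
    by (simp add: inner_diff rMr p_def q_def algebra_simps)
  also have "\<dots> = \<alpha> * q"
    using \<alpha> by (simp add: algebra_simps)
  also have "\<dots> = p * q / (p + q)"
    by (simp add: \<alpha>_def)
  finally show ?thesis
    by (simp add: p_def q_def power2_norm_eq_inner)
qed

lemma norm_residual_step_le:
  fixes M :: "real^'n^'n"
  assumes skew: "transpose M = - M" and "s \<ge> 0" and bound: "norm (M *v r) \<le> s * norm r"
  shows "norm (residual_step (mat 1 - M) r) \<le> s / sqrt (1 + s\<^sup>2) * norm r"
proof (cases "r = 0")
  case True
  then show ?thesis by (simp add: residual_step_def)
next
  case False
  define p q where "p = (norm r)\<^sup>2" and "q = (norm (M *v r))\<^sup>2"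
  have p: "p > 0" and q: "q \<ge> 0"
    using False by (simp_all add: p_def q_def)
  have "q \<le> (s * norm r)\<^sup>2"
    unfolding q_def using bound by (intro power_mono) auto
  then have le: "q \<le> s\<^sup>2 * p"
    by (simp add: p_def power_mult_distrib)
  have s: "1 + s\<^sup>2 > 0"
    by (simp add: add_pos_nonneg)
  have "q / (p + q) \<le> s\<^sup>2 / (1 + s\<^sup>2)"
    using p q s le
    by (intro mult_imp_div_pos_le) (simp_all add: pos_le_divide_eq algebra_simps)
  then have "p * (q / (p + q)) \<le> p * (s\<^sup>2 / (1 + s\<^sup>2))"
    using p by (intro mult_left_mono) auto
  then have "(norm (residual_step (mat 1 - M) r))\<^sup>2 \<le> (s / sqrt (1 + s\<^sup>2) * norm r)\<^sup>2"
    using s by (simp add: norm_residual_step[OF skew] p_def q_def power_mult_distrib power_divide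
        mult.commute)
  then show ?thesis
    by (rule power2_le_imp_le) (simp add: assms(2))
qed

lemma norm_residual_step_eq:
  fixes M :: "real^'n^'n"
  assumes skew: "transpose M = - M" and "s \<ge> 0" and eq: "norm (M *v r) = s * norm r"
  shows "norm (residual_step (mat 1 - M) r) = s / sqrt (1 + s\<^sup>2) * norm r"
proof -
  have s: "1 + s\<^sup>2 > 0"
    by (simp add: add_pos_nonneg)
  have "(norm (residual_step (mat 1 - M) r))\<^sup>2 =
    (norm r)\<^sup>2 * (s * norm r)\<^sup>2 / ((1 + s\<^sup>2) * (norm r)\<^sup>2)"
    by (simp add: norm_residual_step[OF skew] eq power_mult_distrib algebra_simps)
  also have "\<dots> = (s / sqrt (1 + s\<^sup>2) * norm r)\<^sup>2"
    using s by (cases "r = 0") (simp_all add: power_mult_distrib power_divide)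
  finally show ?thesis
    using assms(2) by (simp add: power2_eq_iff_nonneg)
qed

lemma residual_step_eigenspace:
  fixes M :: "real^'n^'n"
  assumes "M *v (M *v r) = - (c *\<^sub>R r)"
  shows "M *v (M *v residual_step (mat 1 - M) r) = - (c *\<^sub>R residual_step (mat 1 - M) r)"
  using assms
  by (simp add: residual_step_def matrix_vector_mult_diff_rdistrib matrix_vector_mult_diff_distrib
      matrix_vector_mult_scaleR matrix_vector_mult_uminus algebra_simps)

text \<open>
  \<open>A x = 0\<close> means \<open>x = M x\<close>, which is orthogonal to \<open>x\<close>; so \<open>A\<close> is injective and hence onto.
\<close>

lemma surj_identity_minus_skew:
  fixes M :: "real^'n^'n"
  assumes skew: "transpose M = - M"
  shows "surj ((*v) (mat 1 - M))"
proof -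
  have "x = 0" if "(mat 1 - M) *v x = 0" for x
  proof -
    have "M *v x = x"
      using that by (simp add: matrix_vector_mult_diff_rdistrib)
    then show "x = 0"
      using skew_inner_self[OF skew, of x] by simp
  qed
  then have "inj ((*v) (mat 1 - M))"
    by (simp add: linear_injective_0 matrix_vector_mul_linear)
  then show ?thesis
    by (intro linear_injective_imp_surjective) (simp_all add: matrix_vector_mul_linear)
qed

section \<open>Root-convergence factors\<close>

lemma root_geometric_tendsto:
  fixes q c :: real
  assumes "q \<ge> 0" "c > 0"
  shows "(\<lambda>k. ereal (root k (q ^ k * c))) \<longlonglongrightarrow> ereal q"
proof -
  have "(\<lambda>k. q * root k c) \<longlonglongrightarrow> q * 1"
    using assms by (intro tendsto_mult tendsto_const LIMSEQ_root_const)
  moreover have "\<forall>\<^sub>F k in sequentially. q * root k c = root k (q ^ k * c)"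
    using eventually_gt_at_top[of 0]
    by eventually_elim (simp add: real_root_mult real_root_power_cancel assms)
  ultimately have "(\<lambda>k. root k (q ^ k * c)) \<longlonglongrightarrow> q"
    by (simp add: tendsto_cong)
  then show ?thesis by simp
qed

lemma root_convergence_factor_le:
  assumes "q \<ge> 0"
    and "\<And>k. norm (gmres1_residual A b x0 (Suc k)) \<le> q * norm (gmres1_residual A b x0 k)"
  shows "root_convergence_factor A b x0 \<le> ereal q"
proof -
  \<comment> \<open>The summand 1 keeps the constant positive when the initial residual vanishes.\<close>
  define c where "c = norm (gmres1_residual A b x0 0) + 1"
  have c: "c > 0"
    by (simp add: c_def add_nonneg_pos)
  have bound: "norm (gmres1_residual A b x0 k) \<le> q ^ k * c" for k
  proof (induction k)
    case (Suc k)
    then have "q * norm (gmres1_residual A b x0 k) \<le> q * (q ^ k * c)"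
      using assms(1) by (intro mult_left_mono)
    then show ?case
      using assms(2)[of k] by (simp add: mult.assoc)
  qed (simp add: c_def)
  have "\<forall>\<^sub>F k in sequentially.
      ereal (root k (norm (gmres1_residual A b x0 k))) \<le> ereal (root k (q ^ k * c))"
    using eventually_gt_at_top[of 0] by eventually_elim (simp add: bound)
  then have "root_convergence_factor A b x0 \<le> limsup (\<lambda>k. ereal (root k (q ^ k * c)))"
    unfolding root_convergence_factor_def by (rule Limsup_mono)
  also have "\<dots> = ereal q"
    using root_geometric_tendsto[OF assms(1) c] by (intro lim_imp_Limsup) simp_all
  finally show ?thesis .
qed

lemma root_convergence_factor_eq:
  assumes "q \<ge> 0" and "gmres1_residual A b x0 0 \<noteq> 0"
    and "\<And>k. norm (gmres1_residual A b x0 (Suc k)) = q * norm (gmres1_residual A b x0 k)"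
  shows "root_convergence_factor A b x0 = ereal q"
proof -
  define c where "c = norm (gmres1_residual A b x0 0)"
  have "norm (gmres1_residual A b x0 k) = q ^ k * c" for k
    by (induction k) (simp_all add: assms(3) c_def)
  moreover have "c > 0"
    using assms(2) by (simp add: c_def)
  ultimately show ?thesis
    unfolding root_convergence_factor_def
    using root_geometric_tendsto[OF assms(1)] by (intro lim_imp_Limsup) simp_all
qed

theorem corollary3p3:
  fixes A M :: "real^'n^'n" and b :: "real^'n" and m :: real
  assumes "even CARD('n)"
    and "M = mat 1 - A"
    and "transpose M = - M"
    and "m = max_eigenvalue_modulus M"
  shows "is_worst_case_factor A b (ereal (m / sqrt (1 + m\<^sup>2))) \<and> m / sqrt (1 + m\<^sup>2) < 1"
proof -
  note skew = assms(3)
  have A: "A = mat 1 - M"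
    by (simp add: assms(2))
  obtain v where m: "m \<ge> 0" and bound: "\<And>x. norm (M *v x) \<le> m * norm x"
    and v: "v \<noteq> 0" "M *v (M *v v) = - (m\<^sup>2 *\<^sub>R v)"
    using skew_max_eigenvalue_modulus[OF skew] unfolding assms(4) by blast
  define q where "q = m / sqrt (1 + m\<^sup>2)"
  have q: "q \<ge> 0"
    using m by (simp add: q_def)
  have "root_convergence_factor A b x0 \<le> ereal q" for x0
    by (rule root_convergence_factor_le[OF q],
        unfold gmres1_residual_Suc A q_def, rule norm_residual_step_le[OF skew m bound])
  moreover have "\<exists>x0. root_convergence_factor A b x0 = ereal q"
  proof -
    obtain x0 where "A *v x0 = v + b"
      using surj_identity_minus_skew[OF skew] unfolding A by (metis surjD)
    then have r0: "gmres1_residual A b x0 0 = v"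
      by (simp add: gmres1_residual_0)
    let ?r = "gmres1_residual A b x0"
    have "M *v (M *v ?r k) = - (m\<^sup>2 *\<^sub>R ?r k)" for k
      proof (induction k)
      case (Suc k)
      then show ?case
        unfolding gmres1_residual_Suc A by (rule residual_step_eigenspace)
    qed (simp add: r0 v(2))
    then have "norm (?r (Suc k)) = q * norm (?r k)" for k
      unfolding gmres1_residual_Suc A q_def
      by (intro norm_residual_step_eq[OF skew m] norm_mult_skew_eigenvector[OF skew _ m])
        (simp add: A)
    then show ?thesis
      using root_convergence_factor_eq[OF q] r0 v(1) by blast
  qed
  moreover have "q < 1"
  proof -
    have "m < sqrt (1 + m\<^sup>2)"
      by (rule real_less_rsqrt) simp
    then show ?thesis
      using m unfolding q_def by (subst divide_less_eq_1_pos) linarith+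
  qed
  ultimately show ?thesis
    by (simp add: is_worst_case_factor_def q_def)
qed

end
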